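(* Let $N\ge 2$, let $x_1,\dots,x_N\in[0,1]$ be distinct nodes, two of which are the boundary points $0$ and $1$, and denote the remaining (interior) nodes by $x^1_1,\dots,x^1_{N-2}\in(0,1)$. Let $\phi_k(x)=\phi(\varepsilon|x-x_k|)$, $k=1,\dots,N$, with fixed $\varepsilon>0$, be real-valued smooth radial basis functions for which the interpolation matrix $(\phi_k(x_j))_{j,k=1}^N$ is non-singular. For $\kappa\in\mathbb{C}$ let $M(\kappa)$ be the $N\times N$ matrix with entries $$m_{jk}=\begin{cases}\kappa^2\phi_k(x^1_j)+\phi_k''(x^1_j), & j=1,\dots,N-2,\\ \kappa^2\phi_k(0)-i\kappa\phi_k'(0), & j=N-1,\\ \kappa^2\phi_k(1)+i\kappa\phi_k'(1), & j=N,\end{cases}\qquad k=1,\dots,N.$$ Then there are exactly $2N$ values of $\kappa\in\mathbb{C}$, counted with multiplicity as roots of $\det M(\kappa)$, for which $M(\kappa)$ is singular. At least two of them (with multiplicity) are $\kappa=0$; if $M(\kappa)$ is singular then so is $M(-\bar\kappa)$, so that those with $\operatorname{Re}\kappa\ne0$ come in pairs $(\kappa,-\bar\kappa)$; and at most $N-1$ of them satisfy $\operatorname{Re}\kappa>0$.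
   Context: $M(\kappa)$ is the non-symmetric (Kansa) RBF collocation matrix for the one-dimensional Helmholtz problem $-u''-\kappa^2u=0$ on $(0,1)$ with radiation boundary conditions $-u'(0)-i\kappa u(0)=-2i\kappa$ and $u'(1)-i\kappa u(1)=0$, after multiplying the differential equation by $-1$ and the boundary conditions by $i\kappa$. Primes denote derivatives with respect to $x$, and $i$ is the imaginary unit. *)

theory Defs
  imports
    "HOL-Analysis.Derivative"
    "Jordan_Normal_Form.Determinant"
begin

definition smooth_fun :: "(real \<Rightarrow> real) \<Rightarrow> bool" where
  "smooth_fun f \<longleftrightarrow> (\<forall>n t. ((deriv ^^ n) f) differentiable (at t))"

definition rbf :: "(real \<Rightarrow> real) \<Rightarrow> real \<Rightarrow> real \<Rightarrow> real \<Rightarrow> real" where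
  "rbf \<phi> \<epsilon> c t = \<phi> (\<epsilon> * \<bar>t - c\<bar>)"

(* Matrices of Jordan_Normal_Form are indexed from 0, so the nodes are x 0, ..., x (N - 1). *)

definition interpolation_matrix ::
    "(real \<Rightarrow> real) \<Rightarrow> real \<Rightarrow> nat \<Rightarrow> (nat \<Rightarrow> real) \<Rightarrow> real mat" where
  "interpolation_matrix \<phi> \<epsilon> N x = mat N N (\<lambda>(j, k). rbf \<phi> \<epsilon> (x k) (x j))"

(* Rows 0, ..., N - 3 collocate at the interior nodes y 0, ..., y (N - 3), row N - 2 at the
   boundary point 0 and row N - 1 at the boundary point 1.  The columns follow the order of x,
   which is unrelated to the order of y. *)
definition kansa_matrix ::
    "(real \<Rightarrow> real) \<Rightarrow> real \<Rightarrow> nat \<Rightarrow> (nat \<Rightarrow> real) \<Rightarrow> (nat \<Rightarrow> real) \<Rightarrow> complex \<Rightarrow> complex mat" where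
  "kansa_matrix \<phi> \<epsilon> N x y \<kappa> = mat N N (\<lambda>(j, k).
     let f = rbf \<phi> \<epsilon> (x k) in
     if j < N - 2 then \<kappa>\<^sup>2 * of_real (f (y j)) + of_real (deriv (deriv f) (y j))
     else if j = N - 2 then \<kappa>\<^sup>2 * of_real (f 0) - \<i> * \<kappa> * of_real (deriv f 0)
     else \<kappa>\<^sup>2 * of_real (f 1) + \<i> * \<kappa> * of_real (deriv f 1))"

abbreviation singular_mat :: "'a::semiring_1 mat \<Rightarrow> bool" where
  "singular_mat A \<equiv> \<not> invertible_mat A"

end

theory Submission
  imports Defs "HOL-Computational_Algebra.Fundamental_Theorem_Algebra"
begin

text \<open>
  The determinant of \<open>M \<kappa>\<close> is a polynomial in \<open>\<kappa>\<close>. All entries have degree at most 2, so the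
  coefficient of \<open>\<kappa>\<close> to the power \<open>2 * N\<close> is the determinant of the matrix of quadratic
  coefficients, which is the interpolation matrix with permuted rows. The two boundary rows are
  divisible by \<open>\<kappa>\<close>, which gives the double root at 0. As the basis functions are real,
  \<open>M (- cnj \<kappa>)\<close> is the entrywise conjugate of \<open>M \<kappa>\<close>, so root multiplicities are invariant under
  reflection in the imaginary axis, and at most half of the \<open>2 * N - 2\<close> other roots lie to the right
  of it.
\<close>

lemma invertible_mat_iff_det_nonzero:
  fixes A :: "'a::field mat"
  assumes A: "A \<in> carrier_mat n n"
  shows "invertible_mat A \<longleftrightarrow> det A \<noteq> 0"
proof
  assume "invertible_mat A"
  then obtain B where AB: "A * B = 1\<^sub>m n" and BA: "B * A = 1\<^sub>m (dim_row B)"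
    using A by (auto simp: invertible_mat_def inverts_mat_def)
  have "dim_col B = n" using arg_cong[OF AB, of dim_col] by simp
  moreover have "dim_row B = n" using arg_cong[OF BA, of dim_col] A by simp
  ultimately have B: "B \<in> carrier_mat n n" by auto
  have "det A * det B = 1"
    using det_mult[OF A B] AB by simp
  then show "det A \<noteq> 0" by auto
next
  assume nz: "det A \<noteq> 0"
  let ?B = "inverse (det A) \<cdot>\<^sub>m adj_mat A"
  have "A * ?B = 1\<^sub>m n" "?B * A = 1\<^sub>m n"
    using nz adj_mat[OF A] A
    by (simp_all add: mult_smult_distrib[of _ n n _ n] mult_smult_assoc_mat[of _ n n _ n])
       (rule eq_matI; simp)+
  with A adj_mat(1)[OF A] show "invertible_mat A"
    by (auto simp: invertible_mat_def inverts_mat_def intro!: exI[of _ ?B])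
qed

text \<open>A row permutation changes the determinant only by a sign. This lets the collocation rows
  and the nodes be numbered independently.\<close>

lemma det_permute_rows_nonzero_iff:
  fixes A :: "'a::idom mat"
  assumes "A \<in> carrier_mat n n" and "p permutes {0..<n}"
  shows "det (mat n n (\<lambda>(i, j). A $$ (p i, j))) \<noteq> 0 \<longleftrightarrow> det A \<noteq> 0"
  using det_permute_rows[OF assms] by (simp add: sign_def)

text \<open>Every term of the Leibniz expansion takes one factor from each row, so the rows in
  \<open>I\<close> contribute \<open>card I\<close> factors divisible by \<open>d\<close>.\<close>

lemma power_card_dvd_det:
  assumes A: "A \<in> carrier_mat n n" and I: "I \<subseteq> {0..<n}"
    and dvd: "\<And>i j. i \<in> I \<Longrightarrow> j < n \<Longrightarrow> d dvd A $$ (i, j)"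
  shows "d ^ card I dvd det A"
  unfolding det_def'[OF A]
proof (intro dvd_sum dvd_mult)
  fix p assume "p \<in> {p. p permutes {0..<n}}"
  then have p: "i < n \<Longrightarrow> p i < n" for i
    using permutes_in_image[of p "{0..<n}" i] by auto
  have "d ^ card I = (\<Prod>i\<in>I. d)" by simp
  also have "\<dots> dvd (\<Prod>i\<in>I. A $$ (i, p i))"
    using I by (intro prod_dvd_prod dvd p) auto
  also have "\<dots> dvd (\<Prod>i = 0..<n. A $$ (i, p i))"
    by (rule prod_dvd_prod_subset) (use I in auto)
  finally show "d ^ card I dvd (\<Prod>i = 0..<n. A $$ (i, p i))" .
qed

lemma degree_prod_le_mult_card:
  fixes f :: "'a \<Rightarrow> 'b::comm_semiring_1 poly"
  assumes "\<And>a. a \<in> A \<Longrightarrow> degree (f a) \<le> d"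
  shows "degree (prod f A) \<le> d * card A"
proof (cases "finite A")
  case True
  have "degree (prod f A) \<le> sum (degree \<circ> f) A"
    by (rule degree_prod_sum_le[OF True])
  also have "\<dots> \<le> (\<Sum>a\<in>A. d)"
    by (rule sum_mono) (use assms in auto)
  finally show ?thesis by (simp add: mult.commute)
qed simp

text \<open>Bounds replace exact degrees because an entry may have smaller degree, for instance
  where a basis function vanishes at a node; its coefficient at the bound is then 0.\<close>

lemma coeff_mult_degree_bounds:
  fixes p q :: "'a::comm_semiring_1 poly"
  assumes "degree p \<le> m" "degree q \<le> n"
  shows "coeff (p * q) (m + n) = coeff p m * coeff q n"
proof -
  have "coeff (p * q) (m + n) = (\<Sum>i\<le>m + n. coeff p i * coeff q (m + n - i))"
    by (rule coeff_mult)
  also have "\<dots> = (\<Sum>i\<in>{m}. coeff p i * coeff q (m + n - i))"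
  proof (rule sum.mono_neutral_right)
    show "\<forall>i\<in>{..m + n} - {m}. coeff p i * coeff q (m + n - i) = 0"
    proof
      fix i assume "i \<in> {..m + n} - {m}"
      \<comment> \<open>If \<open>i\<close> is not \<open>m\<close>, either \<open>i\<close> exceeds
        \<open>m\<close> or \<open>m + n - i\<close> exceeds \<open>n\<close>.\<close>
      then consider "degree p < i" | "degree q < m + n - i"
        using assms by fastforce
      then show "coeff p i * coeff q (m + n - i) = 0"
        by cases (simp_all add: coeff_eq_0)
    qed
  qed auto
  finally show ?thesis by simp
qed

lemma coeff_prod_mult_card:
  fixes f :: "'a \<Rightarrow> 'b::comm_semiring_1 poly"
  assumes "\<And>a. a \<in> A \<Longrightarrow> degree (f a) \<le> d"
  shows "coeff (prod f A) (d * card A) = (\<Prod>a\<in>A. coeff (f a) d)"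
  using assms
proof (induction A rule: infinite_finite_induct)
  case (insert a A)
  have "coeff (f a * prod f A) (d + d * card A) = coeff (f a) d * coeff (prod f A) (d * card A)"
    using insert by (intro coeff_mult_degree_bounds degree_prod_le_mult_card) auto
  then show ?case using insert by simp
qed auto

lemma coeff_signof_mult:
  "coeff (signof p * q) n = signof p * coeff (q :: 'a::comm_ring_1 poly) n"
  by (simp add: sign_def)

text \<open>Each Leibniz term is a signed product of \<open>n\<close> entries, so its coefficient at
  \<open>d * n\<close> is the product of the entries' coefficients at \<open>d\<close>. Summing
  gives the Leibniz expansion for the matrix of those coefficients.\<close>

lemma
  fixes A :: "'a::comm_ring_1 poly mat"
  assumes A: "A \<in> carrier_mat n n"
    and deg: "\<And>i j. i < n \<Longrightarrow> j < n \<Longrightarrow> degree (A $$ (i, j)) \<le> d"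
  shows degree_det_le: "degree (det A) \<le> d * n"
    and coeff_det: "coeff (det A) (d * n) = det (map_mat (\<lambda>q. coeff q d) A)"
proof -
  have perm: "i < n \<Longrightarrow> p i < n" if "p permutes {0..<n}" for p i
    using permutes_in_image[OF that, of i] by auto
  have "degree (\<Prod>i = 0..<n. A $$ (i, p i)) \<le> d * n" if "p permutes {0..<n}" for p
    using degree_prod_le_mult_card[of "{0..<n}" "\<lambda>i. A $$ (i, p i)" d] deg perm[OF that] by simp
  then show "degree (det A) \<le> d * n"
    unfolding det_def'[OF A]
    by (intro degree_sum_le finite_permutations) (auto simp: sign_def)
  have "coeff (\<Prod>i = 0..<n. A $$ (i, p i)) (d * n) = (\<Prod>i = 0..<n. coeff (A $$ (i, p i)) d)"
    if "p permutes {0..<n}" for p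
    using coeff_prod_mult_card[of "{0..<n}" "\<lambda>i. A $$ (i, p i)" d] deg perm[OF that] by simp
  then show "coeff (det A) (d * n) = det (map_mat (\<lambda>q. coeff q d) A)"
    using A perm
    by (subst (1 2) det_def'[of _ n])
       (auto simp: coeff_sum coeff_signof_mult intro!: sum.cong prod.cong arg_cong2[where f = "(*)"])
qed

text \<open>The multiset \<open>proots p\<close> counts each root by its order, and over the complex
  numbers its size is the degree.\<close>

lemma sum_order_eq_degree:
  fixes p :: "complex poly"
  assumes "p \<noteq> 0"
  shows "(\<Sum>z | poly p z = 0. Polynomial.order z p) = degree p"
proof -
  have "size (proots p) = degree p" by (rule size_proots_complex)
  then show ?thesis using assms by (simp add: size_multiset_overloaded_eq)
qed

lemma order_neg_cnj:
  fixes p :: "complex poly"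
  assumes sym: "\<And>z. poly p (- cnj z) = cnj (poly p z)" and nz: "p \<noteq> 0"
  shows "Polynomial.order (- cnj a) p = Polynomial.order a p"
proof -
  have le: "Polynomial.order a p \<le> Polynomial.order (- cnj a) p" for a
  proof -
    let ?n = "Polynomial.order a p"
    obtain r where r: "p = [:- a, 1:] ^ ?n * r"
      using order_1[of a p] by (auto elim: dvdE)
    \<comment> \<open>Conjugating the coefficients and substituting \<open>-z\<close> makes
      \<open>q\<close> the polynomial with value \<open>cnj (poly r (- cnj z))\<close> at
      \<open>z\<close>.\<close>
    define q where "q = pcompose (map_poly cnj r) [:0, - 1:]"
    have "poly p z = poly ([:- cnj a, - 1:] ^ ?n * q) z" for z
    proof -
      have "poly p z = cnj (poly p (- cnj z))" using sym[of z] by simp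
      also have "\<dots> = cnj ((- cnj z - a) ^ ?n * poly r (- cnj z))"
        by (subst r) (simp add: poly_power minus_diff_commute[of a "cnj z"])
      also have "\<dots> = poly ([:- cnj a, - 1:] ^ ?n * q) z"
        by (simp add: q_def poly_pcompose poly_power minus_diff_commute[of z "cnj a"])
      finally show ?thesis .
    qed
    then have "p = [:- cnj a, - 1:] ^ ?n * q"
      by (simp add: poly_eq_poly_eq_iff[symmetric] fun_eq_iff)
    also have "[:- cnj a, - 1:] = - [:- (- cnj a), 1:]" by simp
    finally have "[:- (- cnj a), 1:] ^ ?n dvd p"
      by (metis dvd_mult2 dvd_power_same dvd_minus_iff dvd_refl)
    then show ?thesis using nz by (simp only: order_divides) simp
  qed
  \<comment> \<open>The reflection is an involution, so the inequality at \<open>- cnj a\<close> is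
    the converse one.\<close>
  show ?thesis using le[of a] le[of "- cnj a"] by simp
qed

theorem mainTheorem3:
  fixes N :: nat
    and x y :: "nat \<Rightarrow> real"
    and \<phi> :: "real \<Rightarrow> real"
    and \<epsilon> :: real
    and M :: "complex \<Rightarrow> complex mat"
  assumes "N \<ge> 2"
    and "inj_on x {..<N}"
    and "x ` {..<N} \<subseteq> {0..1}"
    and "0 \<in> x ` {..<N}" and "1 \<in> x ` {..<N}"
    and "bij_betw y {..<N - 2} (x ` {..<N} - {0, 1})"
    and "\<epsilon> > 0"
    and "\<forall>k<N. smooth_fun (rbf \<phi> \<epsilon> (x k))"
    and "\<not> singular_mat (interpolation_matrix \<phi> \<epsilon> N x)"
    and "\<And>\<kappa>. M \<kappa> = kansa_matrix \<phi> \<epsilon> N x y \<kappa>"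
  shows "\<exists>p :: complex poly.
      (\<forall>\<kappa>. poly p \<kappa> = det (M \<kappa>)) \<and> p \<noteq> 0 \<and>
      finite {\<kappa>. singular_mat (M \<kappa>)} \<and>
      (\<Sum>\<kappa> | singular_mat (M \<kappa>). Polynomial.order \<kappa> p) = 2 * N \<and>
      singular_mat (M 0) \<and> Polynomial.order 0 p \<ge> 2 \<and>
      (\<forall>\<kappa>. singular_mat (M \<kappa>) \<longrightarrow> singular_mat (M (- cnj \<kappa>))) \<and>
      (\<forall>\<kappa>. singular_mat (M \<kappa>) \<and> Re \<kappa> \<noteq> 0 \<longrightarrow>
         - cnj \<kappa> \<noteq> \<kappa> \<and> Polynomial.order (- cnj \<kappa>) p = Polynomial.order \<kappa> p) \<and>
      (\<Sum>\<kappa> | singular_mat (M \<kappa>) \<and> Re \<kappa> > 0. Polynomial.order \<kappa> p) \<le> N - 1"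
proof -
  \<comment> \<open>\<open>z j\<close> is the point at which row \<open>j\<close>
    collocates.\<close>
  define z where "z j = (if j < N - 2 then y j else if j = N - 2 then 0 else 1)" for j
  \<comment> \<open>\<open>P\<close> is \<open>M \<kappa>\<close> with \<open>\<kappa>\<close> as
    the indeterminate. The boundary rows have constant coefficient 0.\<close>
  define P :: "complex poly mat" where "P = mat N N (\<lambda>(j, k).
     let f = rbf \<phi> \<epsilon> (x k) in
     if j < N - 2 then [:of_real (deriv (deriv f) (y j)), 0, of_real (f (y j)):]
     else if j = N - 2 then [:0, - \<i> * of_real (deriv f 0), of_real (f 0):]
     else [:0, \<i> * of_real (deriv f 1), of_real (f 1):])"
  define p where "p = det P"
  have P: "P \<in> carrier_mat N N" by (simp add: P_def)
  have M: "M \<kappa> \<in> carrier_mat N N" for \<kappa>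
    by (simp add: assms(10) kansa_matrix_def)

  have p_eval: "poly p \<kappa> = det (M \<kappa>)" for \<kappa>
  proof -
    \<comment> \<open>Evaluation at \<open>\<kappa>\<close> is a ring homomorphism and so commutes
      with \<open>det\<close>.\<close>
    interpret comm_ring_hom "\<lambda>q. poly q \<kappa>" by unfold_locales auto
    have "M \<kappa> = map_mat (\<lambda>q. poly q \<kappa>) P"
      by (rule eq_matI)
         (auto simp: assms(10) kansa_matrix_def P_def Let_def power2_eq_square algebra_simps)
    then show ?thesis by (simp add: p_def)
  qed
  have sing: "singular_mat (M \<kappa>) \<longleftrightarrow> poly p \<kappa> = 0" for \<kappa>
    using invertible_mat_iff_det_nonzero[OF M] by (simp add: p_eval)

  have z_bij: "bij_betw z {0..<N} (x ` {0..<N})"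
  proof -
    have "bij_betw z {..<N - 2} (x ` {..<N} - {0, 1})"
      using assms(6) by (rule bij_betw_cong[THEN iffD1, rotated]) (simp add: z_def)
    moreover have "bij_betw z {N - 2, N - 1} {0, 1}"
      using assms(1) by (auto simp: bij_betw_def z_def)
    ultimately have "bij_betw z ({..<N - 2} \<union> {N - 2, N - 1}) (x ` {..<N} - {0, 1} \<union> {0, 1})"
      by (rule bij_betw_combine) auto
    moreover have "{..<N - 2} \<union> {N - 2, N - 1} = {0..<N}" using assms(1) by auto
    moreover have "x ` {..<N} - {0, 1} \<union> {0, 1} = x ` {0..<N}"
      using assms(4,5) by (auto simp: lessThan_atLeast0)
    ultimately show ?thesis by simp
  qed
  have x_bij: "bij_betw x {0..<N} (x ` {0..<N})"
    using assms(2) by (simp add: bij_betw_def lessThan_atLeast0)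
  \<comment> \<open>\<open>\<sigma> j\<close> is the index in \<open>x\<close> of the node of row
    \<open>j\<close>; \<open>permutes\<close> requires the identity outside the index range.\<close>
  define \<sigma> where "\<sigma> j = (if j < N then inv_into {0..<N} x (z j) else j)" for j
  have "bij_betw \<sigma> {0..<N} {0..<N}"
    using bij_betw_trans[OF z_bij bij_betw_inv_into[OF x_bij]]
    by (rule bij_betw_cong[THEN iffD1, rotated]) (simp add: \<sigma>_def)
  then have \<sigma>: "\<sigma> permutes {0..<N}"
    by (rule bij_imp_permutes) (simp add: \<sigma>_def)
  have \<sigma>_less: "\<sigma> j < N" if "j < N" for j
    using permutes_in_image[OF \<sigma>, of j] that by simp
  have x_\<sigma>: "x (\<sigma> j) = z j" if "j < N" for j
    using that bij_betw_apply[OF z_bij, of j] by (simp add: \<sigma>_def f_inv_into_f)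

  let ?A = "interpolation_matrix \<phi> \<epsilon> N x"
  let ?B = "mat N N (\<lambda>(j, k). ?A $$ (\<sigma> j, k))"
  have A: "?A \<in> carrier_mat N N" by (simp add: interpolation_matrix_def)
  \<comment> \<open>In every row \<open>j\<close>, interior or boundary, the quadratic coefficient
    is the basis function's value at \<open>z j\<close>, which is
    \<open>x (\<sigma> j)\<close>.\<close>
  have lead: "map_mat (\<lambda>q. coeff q 2) P = map_mat of_real ?B"
    by (rule eq_matI)
       (auto simp: P_def interpolation_matrix_def Let_def \<sigma>_less x_\<sigma> z_def numeral_2_eq_2)
  have "det ?B \<noteq> 0"
    using assms(9) invertible_mat_iff_det_nonzero[OF A] det_permute_rows_nonzero_iff[OF A \<sigma>]
    by simp
  have degP: "degree (P $$ (i, j)) \<le> 2" if "i < N" "j < N" for i j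
    using that by (auto simp: P_def Let_def)
  have "coeff p (2 * N) = det (map_mat of_real ?B)"
    unfolding p_def lead[symmetric] by (rule coeff_det[OF P degP])
  also have "\<dots> = of_real (det ?B)" by simp
  finally have coeff: "coeff p (2 * N) \<noteq> 0" using \<open>det ?B \<noteq> 0\<close> by simp
  then have nz: "p \<noteq> 0" by auto
  have deg: "degree p = 2 * N"
    using degree_det_le[OF P degP] le_degree[OF coeff] by (simp add: p_def)

  have "[:0, 1:] ^ card {N - 2, N - 1} dvd p"
    unfolding p_def
    by (rule power_card_dvd_det[OF P])
       (use assms(1) in \<open>auto simp: P_def Let_def dvd_iff_poly_eq_0\<close>)
  moreover have "card {N - 2, N - 1} = 2" using assms(1) by simp
  ultimately have ord0: "Polynomial.order 0 p \<ge> 2"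
    using nz order_divides[of 0 2 p] by simp
  then have root0: "poly p 0 = 0" using order_root[of p 0] by auto

  have sym: "poly p (- cnj \<kappa>) = cnj (poly p \<kappa>)" for \<kappa>
  proof -
    interpret comm_ring_hom cnj by unfold_locales auto
    \<comment> \<open>Both \<open>\<kappa>\<^sup>2\<close> and \<open>\<i> * \<kappa>\<close> turn
      into their conjugates under the reflection, and all other data are real.\<close>
    have "M (- cnj \<kappa>) = map_mat cnj (M \<kappa>)"
      by (rule eq_matI) (auto simp: assms(10) kansa_matrix_def Let_def)
    then show ?thesis by (simp add: p_eval)
  qed
  note ord = order_neg_cnj[OF sym nz]
  have root_sym: "poly p (- cnj \<kappa>) = 0 \<longleftrightarrow> poly p \<kappa> = 0" for \<kappa>
    by (simp add: sym)

  let ?S = "{\<kappa>. poly p \<kappa> = 0}"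
  let ?R = "{\<kappa>. poly p \<kappa> = 0 \<and> Re \<kappa> > 0}"
  let ?L = "{\<kappa>. poly p \<kappa> = 0 \<and> Re \<kappa> < 0}"
  let ?o = "\<lambda>\<kappa>. Polynomial.order \<kappa> p"
  have fin: "finite ?S" by (rule poly_roots_finite[OF nz])
  then have finR: "finite ?R" and finL: "finite ?L" by (auto elim: rev_finite_subset)
  have total: "sum ?o ?S = 2 * N" using sum_order_eq_degree[OF nz] deg by simp
  have "bij_betw (\<lambda>\<kappa>. - cnj \<kappa>) ?R ?L"
    by (rule bij_betwI[where g = "\<lambda>\<kappa>. - cnj \<kappa>"]) (auto simp: root_sym)
  from sum.reindex_bij_betw[OF this, of ?o] have LR: "sum ?o ?L = sum ?o ?R"
    by (simp add: ord)
  \<comment> \<open>Nonzero roots on the imaginary axis are left out, so the comparison with the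
    total is only an inequality: \<open>2 + 2 * sum ?o ?R\<close> is at most
    \<open>2 * N\<close>.\<close>
  have "?o 0 + (sum ?o ?R + sum ?o ?L) = sum ?o (insert 0 (?R \<union> ?L))"
    using finR finL sum.union_disjoint[of ?R ?L ?o] by (subst sum.insert) fastforce+
  also have "\<dots> \<le> sum ?o ?S"
    by (rule sum_mono2[OF fin]) (use root0 in auto)
  finally have half: "sum ?o ?R \<le> N - 1"
    using total LR ord0 by linarith

  have off_axis: "- cnj \<kappa> \<noteq> \<kappa>" if "Re \<kappa> \<noteq> 0" for \<kappa>
    using that by (auto simp: complex_eq_iff)
  show ?thesis
    by (rule exI[of _ p])
       (use p_eval nz fin total root0 ord0 root_sym off_axis ord half in \<open>simp add: sing\<close>)
qed

end
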